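(* There exist a Hilbert space $H$ and two unbounded densely defined closed operators $A$ and $B$ in $H$ such that, for every closed linear operator $T$ in $H$ with domain $D(T)\subset H$, $TA\subset BT$ implies $T=0$ (that is, $D(T)=H$ and $Tx=0$ for all $x\in H$).
   Context: $H$ is a complex Hilbert space. For operators $R,S$ in $H$, $R\subset S$ means $D(R)\subset D(S)$ and $Rx=Sx$ for all $x\in D(R)$; products carry their natural domains, $D(RS)=\{x\in D(S): Sx\in D(R)\}$. *)

theory Defs
  imports "HOL-Analysis.Analysis" "HOL-Algebra.Module"
begin

section \<open>Complex Hilbert spaces on an explicit carrier\<close>

definition complex_ring :: "complex ring" where
  "complex_ring = \<lparr>carrier = UNIV, mult = (*), one = 1, zero = 0, add = (+)\<rparr>"

text \<open>
  The Hilbert space is existentially quantified in the theorem, so it is a record and not a type.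
  Carriers inside \<open>nat \<Rightarrow> complex\<close> accommodate, up to isomorphism, every Hilbert space of dimension
  at most the continuum.
  The fields \<open>mult\<close> and \<open>one\<close> inherited from the library's module record are unused.
\<close>

record 'a inner_space = "(complex, 'a) module" +
  ip :: "'a \<Rightarrow> 'a \<Rightarrow> complex"

locale complex_inner_space = Module.module complex_ring H
  for H :: "('a, 'm) inner_space_scheme" (structure) +
  assumes ip_add_left:
      "\<lbrakk>x \<in> carrier H; y \<in> carrier H; z \<in> carrier H\<rbrakk>
        \<Longrightarrow> ip H (x \<oplus>\<^bsub>H\<^esub> y) z = ip H x z + ip H y z"
    and ip_smult_left:
      "\<lbrakk>x \<in> carrier H; y \<in> carrier H\<rbrakk> \<Longrightarrow> ip H (c \<odot>\<^bsub>H\<^esub> x) y = c * ip H x y"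
    and ip_commute:
      "\<lbrakk>x \<in> carrier H; y \<in> carrier H\<rbrakk> \<Longrightarrow> ip H y x = cnj (ip H x y)"
    and ip_pos:
      "\<lbrakk>x \<in> carrier H; x \<noteq> \<zero>\<^bsub>H\<^esub>\<rbrakk> \<Longrightarrow> 0 < Re (ip H x x)"

definition hnorm :: "('a, 'm) inner_space_scheme \<Rightarrow> 'a \<Rightarrow> real" where
  "hnorm H x = sqrt (Re (ip H x x))"

text \<open>
  The locale \<open>Metric_space\<close> requires non-negativity and symmetry also for arguments outside
  the carrier, hence the case distinction.
\<close>

definition hdist :: "('a, 'm) inner_space_scheme \<Rightarrow> 'a \<Rightarrow> 'a \<Rightarrow> real" where
  "hdist H x y = (if x \<in> carrier H \<and> y \<in> carrier H then hnorm H (x \<ominus>\<^bsub>H\<^esub> y) else 0)"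

abbreviation htopology :: "('a, 'm) inner_space_scheme \<Rightarrow> 'a topology" where
  "htopology H \<equiv> Metric_space.mtopology (carrier H) (hdist H)"

locale complex_hilbert_space = complex_inner_space +
  assumes complete: "Metric_space.mcomplete (carrier H) (hdist H)"

context complex_inner_space
begin

lemma ip_add_right:
  assumes "x \<in> carrier H" "y \<in> carrier H" "z \<in> carrier H"
  shows "ip H x (y \<oplus>\<^bsub>H\<^esub> z) = ip H x y + ip H x z"
  using assms ip_add_left[of y z x] ip_commute[of "y \<oplus>\<^bsub>H\<^esub> z" x]
    ip_commute[of y x] ip_commute[of z x] by simp

lemma smult_carrier [simp]: "x \<in> carrier H \<Longrightarrow> c \<odot>\<^bsub>H\<^esub> x \<in> carrier H"
  using smult_closed[of c x] by (simp add: complex_ring_def)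

lemma ip_smult_right:
  assumes "x \<in> carrier H" "y \<in> carrier H"
  shows "ip H x (c \<odot>\<^bsub>H\<^esub> y) = cnj c * ip H x y"
  using assms ip_smult_left[of y x c] ip_commute[of "c \<odot>\<^bsub>H\<^esub> y" x]
    ip_commute[of y x] by simp

lemma ip_zero_left [simp]: "x \<in> carrier H \<Longrightarrow> ip H \<zero>\<^bsub>H\<^esub> x = 0"
  using ip_add_left[of "\<zero>\<^bsub>H\<^esub>" "\<zero>\<^bsub>H\<^esub>" x] by simp

lemma ip_zero_right [simp]: "x \<in> carrier H \<Longrightarrow> ip H x \<zero>\<^bsub>H\<^esub> = 0"
  using ip_add_right[of x "\<zero>\<^bsub>H\<^esub>" "\<zero>\<^bsub>H\<^esub>"] by simp

lemma ip_self_nonneg: "x \<in> carrier H \<Longrightarrow> 0 \<le> Re (ip H x x)"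
  using ip_pos[of x] by (cases "x = \<zero>\<^bsub>H\<^esub>") auto

lemma ip_self_real: "x \<in> carrier H \<Longrightarrow> ip H x x = of_real (Re (ip H x x))"
  using ip_commute[of x x] by (metis complex_is_Real_iff of_real_Re Reals_cnj_iff)

lemma Cauchy_Schwarz:
  assumes x: "x \<in> carrier H" and y: "y \<in> carrier H"
  shows "(cmod (ip H x y))\<^sup>2 \<le> Re (ip H x x) * Re (ip H y y)"
proof (cases "y = \<zero>\<^bsub>H\<^esub>")
  case True
  then show ?thesis using x by simp
next
  case False
  define n where "n = Re (ip H y y)"
  define p where "p = ip H x y"
  have n: "n > 0" and yy: "ip H y y = of_real n"
    using ip_pos[OF y False] ip_self_real[OF y] by (simp_all add: n_def)
  have yx: "ip H y x = cnj p"
    using ip_commute[OF x y] by (simp add: p_def)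
  define c where "c = - p / of_real n"
  define z where "z = x \<oplus>\<^bsub>H\<^esub> c \<odot>\<^bsub>H\<^esub> y"
  have "ip H z z = ip H x x + cnj c * p + c * cnj p + c * cnj c * of_real n"
    using x y
    by (simp add: z_def ip_add_left ip_add_right ip_smult_left ip_smult_right yy yx
        flip: p_def) (simp add: algebra_simps)
  also have "\<dots> = ip H x x - p * cnj p / of_real n"
    using n by (simp add: c_def field_simps)
  also have "p * cnj p / of_real n = of_real ((cmod p)\<^sup>2 / n)"
    by (metis complex_norm_square of_real_divide)
  finally have "Re (ip H z z) = Re (ip H x x) - (cmod p)\<^sup>2 / n"
    by simp
  moreover have "0 \<le> Re (ip H z z)"
    using x y by (intro ip_self_nonneg) (simp add: z_def)
  ultimately have "(cmod p)\<^sup>2 / n \<le> Re (ip H x x)"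
    by simp
  then show ?thesis
    using n by (simp add: field_simps n_def p_def)
qed

lemma hnorm_triangle:
  assumes x: "x \<in> carrier H" and y: "y \<in> carrier H"
  shows "hnorm H (x \<oplus>\<^bsub>H\<^esub> y) \<le> hnorm H x + hnorm H y"
proof -
  have "cmod (ip H x y) \<le> hnorm H x * hnorm H y"
    using real_le_rsqrt[OF Cauchy_Schwarz[OF x y]]
    by (simp add: hnorm_def real_sqrt_mult)
  then have "Re (ip H x y) \<le> hnorm H x * hnorm H y"
    using complex_Re_le_cmod[of "ip H x y"] by linarith
  moreover have "Re (ip H (x \<oplus>\<^bsub>H\<^esub> y) (x \<oplus>\<^bsub>H\<^esub> y))
      = (hnorm H x)\<^sup>2 + 2 * Re (ip H x y) + (hnorm H y)\<^sup>2"
    using x y ip_commute[OF x y]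
    by (simp add: ip_add_left ip_add_right hnorm_def ip_self_nonneg)
  ultimately have "Re (ip H (x \<oplus>\<^bsub>H\<^esub> y) (x \<oplus>\<^bsub>H\<^esub> y)) \<le> (hnorm H x + hnorm H y)\<^sup>2"
    by (simp add: power2_sum)
  moreover have "0 \<le> hnorm H x + hnorm H y"
    using x y by (simp add: hnorm_def ip_self_nonneg)
  ultimately show ?thesis
    unfolding hnorm_def[of H "x \<oplus>\<^bsub>H\<^esub> y"] by (rule real_le_lsqrt[rotated])
qed

lemma hnorm_nonneg: "x \<in> carrier H \<Longrightarrow> 0 \<le> hnorm H x"
  by (simp add: hnorm_def ip_self_nonneg)

lemma hnorm_eq_0_iff: "x \<in> carrier H \<Longrightarrow> hnorm H x = 0 \<longleftrightarrow> x = \<zero>\<^bsub>H\<^esub>"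
  using ip_pos[of x] by (cases "x = \<zero>\<^bsub>H\<^esub>") (auto simp: hnorm_def)

lemma ip_neg_left: "x \<in> carrier H \<Longrightarrow> y \<in> carrier H \<Longrightarrow> ip H (\<ominus>\<^bsub>H\<^esub> x) y = - ip H x y"
  using ip_add_left[of x "\<ominus>\<^bsub>H\<^esub> x" y] by (simp add: M.r_neg add_eq_0_iff)

lemma ip_neg_neg:
  assumes "x \<in> carrier H"
  shows "ip H (\<ominus>\<^bsub>H\<^esub> x) (\<ominus>\<^bsub>H\<^esub> x) = ip H x x"
  using assms ip_neg_left[of x "\<ominus>\<^bsub>H\<^esub> x"] ip_neg_left[of x x]
    ip_commute[of "\<ominus>\<^bsub>H\<^esub> x" x] ip_commute[of x x] by simp

sublocale Metric_space "carrier H" "hdist H"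
proof
  show "0 \<le> hdist H x y" for x y
    by (simp add: hdist_def hnorm_nonneg)
  show "hdist H x y = hdist H y x" for x y
  proof (cases "x \<in> carrier H \<and> y \<in> carrier H")
    case True
    then have "y \<ominus>\<^bsub>H\<^esub> x = \<ominus>\<^bsub>H\<^esub> (x \<ominus>\<^bsub>H\<^esub> y)"
      by (simp add: M.minus_eq M.minus_add M.a_comm)
    then show ?thesis
      using True by (simp add: hdist_def hnorm_def ip_neg_neg)
  qed (auto simp: hdist_def)
  show "hdist H x y = 0 \<longleftrightarrow> x = y" if "x \<in> carrier H" "y \<in> carrier H" for x y
    using that M.minus_equality[of x "\<ominus>\<^bsub>H\<^esub> y"]
    by (auto simp: hdist_def hnorm_eq_0_iff M.minus_eq M.r_neg)
  show "hdist H x z \<le> hdist H x y + hdist H y z"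
    if "x \<in> carrier H" "y \<in> carrier H" "z \<in> carrier H" for x y z
  proof -
    have "(x \<ominus>\<^bsub>H\<^esub> y) \<oplus>\<^bsub>H\<^esub> (y \<ominus>\<^bsub>H\<^esub> z) = x \<ominus>\<^bsub>H\<^esub> z"
      using that by (simp add: M.minus_eq M.a_assoc M.r_neg1)
    then show ?thesis
      using that hnorm_triangle[of "x \<ominus>\<^bsub>H\<^esub> y" "y \<ominus>\<^bsub>H\<^esub> z"] by (simp add: hdist_def)
  qed
qed

end

section \<open>Operators in a Hilbert space\<close>

text \<open>
  An operator \<open>T\<close> in \<open>H\<close> with domain \<open>D(T)\<close> is a partial map with \<open>dom T = D(T)\<close>.  The library's
  \<open>R \<subseteq>\<^sub>m S\<close> is then the inclusion of operators, and \<open>R \<circ>\<^sub>m S\<close> is the product with its natural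
  domain \<open>{x \<in> D(S). S x \<in> D(R)}\<close>.
\<close>

definition linear_operator ::
    "('a, 'm) inner_space_scheme \<Rightarrow> ('a \<rightharpoonup> 'a) \<Rightarrow> bool" where
  "linear_operator H T \<longleftrightarrow>
     submodule (dom T) complex_ring H \<and> ran T \<subseteq> carrier H \<and>
     (\<forall>x\<in>dom T. \<forall>y\<in>dom T. the (T (x \<oplus>\<^bsub>H\<^esub> y)) = the (T x) \<oplus>\<^bsub>H\<^esub> the (T y)) \<and>
     (\<forall>c. \<forall>x\<in>dom T. the (T (c \<odot>\<^bsub>H\<^esub> x)) = c \<odot>\<^bsub>H\<^esub> the (T x))"

definition closed_operator ::
    "('a, 'm) inner_space_scheme \<Rightarrow> ('a \<rightharpoonup> 'a) \<Rightarrow> bool" where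
  "closed_operator H T \<longleftrightarrow>
     linear_operator H T \<and> closedin (prod_topology (htopology H) (htopology H)) (Map.graph T)"

definition densely_defined ::
    "('a, 'm) inner_space_scheme \<Rightarrow> ('a \<rightharpoonup> 'a) \<Rightarrow> bool" where
  "densely_defined H T \<longleftrightarrow> (htopology H) closure_of (dom T) = carrier H"

definition unbounded_operator ::
    "('a, 'm) inner_space_scheme \<Rightarrow> ('a \<rightharpoonup> 'a) \<Rightarrow> bool" where
  "unbounded_operator H T \<longleftrightarrow> \<not> (\<exists>c. \<forall>x\<in>dom T. hnorm H (the (T x)) \<le> c * hnorm H x)"

definition zero_operator :: "('a, 'm) inner_space_scheme \<Rightarrow> ('a \<rightharpoonup> 'a)" where
  "zero_operator H = (\<lambda>x. if x \<in> carrier H then Some \<zero>\<^bsub>H\<^esub> else None)"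

end

theory Submission
  imports Defs
begin

text \<open>
  The inclusion \<open>T A \<subset> B T\<close> says nothing about vectors outside the domain of \<open>T A\<close>, so \<open>A\<close> has to
  force this domain to be large.  If \<open>A\<close> maps its domain into its own kernel, this happens in
  two steps, which at the same time compute \<open>T\<close>.  For \<open>x\<close> in the kernel, \<open>A x = 0\<close> lies in
  \<open>D(T)\<close>, whatever \<open>D(T)\<close> is; hence \<open>x \<in> D(T)\<close> and \<open>B T x = T A x = 0\<close>, and \<open>T x = 0\<close> if \<open>B\<close> is injective.
  For an arbitrary \<open>x \<in> D(A)\<close>, the vector \<open>A x\<close> lies in the kernel, where \<open>T\<close> is now known to vanish,
  and the same argument gives \<open>T x = 0\<close>.  A closed operator that vanishes on the dense set
  \<open>D(A)\<close> is the zero operator on the whole space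
  (\<open>intertwiner_square_zero_injective\<close>).

  It remains to exhibit \<open>A\<close> and \<open>B\<close>.  On square-summable sequences take
  \<open>(A x) n = n x (n + 1)\<close> for even \<open>n\<close> and \<open>(A x) n = 0\<close> for odd \<open>n\<close>, and \<open>(B x) n = (n + 1) x n\<close>.
  Values of \<open>A\<close> live on the even coordinates and \<open>A\<close> reads only the odd ones, so \<open>A\<close> sends its values
  to zero; \<open>B\<close> is injective because its weights do not vanish.  Both have the shape
  \<open>x \<mapsto> (\<lambda>n. w n * x (p n))\<close> on the maximal domain, with \<open>p\<close> injective and \<open>w\<close> unbounded, and such
  operators are closed, densely defined and unbounded.
\<close>

section \<open>Intertwining a square-zero operator with an injective one\<close>

lemma (in complex_inner_space) linear_operator_zero:
  assumes "linear_operator H T"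
  shows "T \<zero>\<^bsub>H\<^esub> = Some \<zero>\<^bsub>H\<^esub>"
proof -
  have sub: "submodule (dom T) complex_ring H" and ran: "ran T \<subseteq> carrier H"
    and sm: "\<And>c x. x \<in> dom T \<Longrightarrow> the (T (c \<odot>\<^bsub>H\<^esub> x)) = c \<odot>\<^bsub>H\<^esub> the (T x)"
    using assms by (auto simp: linear_operator_def)
  have z: "0 \<odot>\<^bsub>H\<^esub> x = \<zero>\<^bsub>H\<^esub>" if "x \<in> carrier H" for x
    using smult_l_null[OF that] by (simp add: complex_ring_def)
  have "\<zero>\<^bsub>H\<^esub> \<in> dom T"
    using subgroup.one_closed[OF submodule.axioms(1)[OF sub]] by simp
  then obtain y where y: "T \<zero>\<^bsub>H\<^esub> = Some y" by blast
  then have "y \<in> carrier H" using ran by (auto simp: ran_def)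
  then show ?thesis using sm[of "\<zero>\<^bsub>H\<^esub>" 0] z y by auto
qed

text \<open>
  The vectors that a closed \<open>T\<close> sends to zero form a closed set, the preimage of its graph under
  \<open>x \<mapsto> (x, 0)\<close>.  In particular the domain, which is only assumed to contain \<open>D\<close>, turns out to be
  everything.
\<close>

lemma (in complex_inner_space) closed_operator_zero_on_dense:
  assumes T: "closed_operator H T"
    and dense: "htopology H closure_of D = carrier H"
    and zero: "\<And>x. x \<in> D \<Longrightarrow> T x = Some \<zero>\<^bsub>H\<^esub>"
  shows "T = zero_operator H"
proof -
  have lin: "linear_operator H T"
    and clo: "closedin (prod_topology mtopology mtopology) (Map.graph T)"
    using T by (auto simp: closed_operator_def)
  have "submodule (dom T) complex_ring H"
    using lin by (simp add: linear_operator_def)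
  then have dom: "dom T \<subseteq> carrier H"
    using subgroup.subset[OF submodule.axioms(1)] by fastforce
  define Z where "Z = {x \<in> topspace mtopology. (x, \<zero>\<^bsub>H\<^esub>) \<in> Map.graph T}"
  have "continuous_map mtopology (prod_topology mtopology mtopology) (\<lambda>x. (x, \<zero>\<^bsub>H\<^esub>))"
    by (simp add: continuous_map_paired)
  then have "closedin mtopology Z"
    unfolding Z_def using clo by (rule closedin_continuous_map_preimage)
  moreover have "D \<subseteq> Z"
    using zero dom by (auto simp: Z_def Map.graph_def)
  ultimately have "mtopology closure_of D \<subseteq> Z"
    by (simp add: closure_of_minimal)
  then have "T x = Some \<zero>\<^bsub>H\<^esub>" if "x \<in> carrier H" for x
    using that dense by (auto simp: Z_def Map.graph_def)
  moreover have "T x = None" if "x \<notin> carrier H" for x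
    using that dom by blast
  ultimately show ?thesis
    by (auto simp: zero_operator_def)
qed

text \<open>
  The assumption \<open>square_zero\<close> includes that \<open>A\<close> maps its domain into itself.  Domain membership in
  \<open>D(T)\<close> is obtained from the equation \<open>T A x = 0\<close>: as soon as the left-hand side is defined, so is
  \<open>B T x\<close>.
\<close>

lemma (in complex_inner_space) intertwiner_square_zero_injective:
  assumes T: "closed_operator H T" and TA: "T \<circ>\<^sub>m A \<subseteq>\<^sub>m B \<circ>\<^sub>m T"
    and dense: "densely_defined H A"
    and square_zero: "\<And>x y. A x = Some y \<Longrightarrow> A y = Some \<zero>\<^bsub>H\<^esub>"
    and inj: "\<And>x. B x = Some \<zero>\<^bsub>H\<^esub> \<Longrightarrow> x = \<zero>\<^bsub>H\<^esub>"
  shows "T = zero_operator H"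
proof -
  have T0: "T \<zero>\<^bsub>H\<^esub> = Some \<zero>\<^bsub>H\<^esub>"
    using T by (intro linear_operator_zero) (simp add: closed_operator_def)
  have step: "T x = Some \<zero>\<^bsub>H\<^esub>" if "A x = Some y" "T y = Some \<zero>\<^bsub>H\<^esub>" for x y
  proof -
    have "(T \<circ>\<^sub>m A) x = Some \<zero>\<^bsub>H\<^esub>"
      using that by simp
    then have "(B \<circ>\<^sub>m T) x = Some \<zero>\<^bsub>H\<^esub>"
      using TA unfolding map_le_def by (metis domI)
    then show ?thesis
      using inj by (auto simp: map_comp_Some_iff)
  qed
  have "T x = Some \<zero>\<^bsub>H\<^esub>" if x: "x \<in> dom A" for x
  proof -
    obtain y where y: "A x = Some y"
      using x by blast
    \<comment> \<open>First for the kernel vector \<open>y\<close>, starting from the zero vector, and then for \<open>x\<close>.\<close>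
    have "T y = Some \<zero>\<^bsub>H\<^esub>"
      using square_zero[OF y] T0 by (rule step)
    with y show ?thesis by (rule step)
  qed
  with T dense show ?thesis
    by (intro closed_operator_zero_on_dense[of T "dom A"]) (simp_all add: densely_defined_def)
qed

section \<open>The Hilbert space of square-summable sequences\<close>

definition square_summable :: "(nat \<Rightarrow> complex) \<Rightarrow> bool" where
  "square_summable x \<longleftrightarrow> summable (\<lambda>n. (cmod (x n))\<^sup>2)"

definition ell2 :: "(nat \<Rightarrow> complex) inner_space" where
  "ell2 = \<lparr>carrier = Collect square_summable,
     mult = (\<lambda>x y n. x n * y n), one = (\<lambda>n. 1),
     zero = (\<lambda>n. 0), add = (\<lambda>x y n. x n + y n),
     smult = (\<lambda>c x n. c * x n), ip = (\<lambda>x y. \<Sum>n. x n * cnj (y n))\<rparr>"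

lemma ell2_simps [simp]:
  "x \<in> carrier ell2 \<longleftrightarrow> square_summable x"
  "\<zero>\<^bsub>ell2\<^esub> = (\<lambda>n. 0)"
  "x \<oplus>\<^bsub>ell2\<^esub> y = (\<lambda>n. x n + y n)"
  "c \<odot>\<^bsub>ell2\<^esub> x = (\<lambda>n. c * x n)"
  "ip ell2 x y = (\<Sum>n. x n * cnj (y n))"
  by (simp_all add: ell2_def)

lemma square_summable_smult [simp]:
  "square_summable x \<Longrightarrow> square_summable (\<lambda>n. c * x n)"
  by (simp add: square_summable_def norm_mult power_mult_distrib summable_mult)

lemma square_summable_add [simp]:
  assumes "square_summable x" "square_summable y"
  shows "square_summable (\<lambda>n. x n + y n)"
  unfolding square_summable_def
proof (rule summable_comparison_test')
  show "summable (\<lambda>n. 2 * (cmod (x n))\<^sup>2 + 2 * (cmod (y n))\<^sup>2)"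
    using assms by (auto simp: square_summable_def intro: summable_add summable_mult)
  fix n
  have "(cmod (x n + y n))\<^sup>2 \<le> (cmod (x n) + cmod (y n))\<^sup>2"
    by (intro power_mono norm_triangle_ineq) simp
  also have "\<dots> \<le> 2 * (cmod (x n))\<^sup>2 + 2 * (cmod (y n))\<^sup>2"
    using sum_squares_bound[of "cmod (x n)" "cmod (y n)"] by (simp add: power2_sum)
  finally show "norm ((cmod (x n + y n))\<^sup>2) \<le> 2 * (cmod (x n))\<^sup>2 + 2 * (cmod (y n))\<^sup>2"
    by simp
qed

lemma square_summable_minus [simp]: "square_summable (\<lambda>n. - x n) \<longleftrightarrow> square_summable x"
  by (simp add: square_summable_def)

lemma square_summable_diff [simp]:
  "square_summable x \<Longrightarrow> square_summable y \<Longrightarrow> square_summable (\<lambda>n. x n - y n)"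
  using square_summable_add[of x "\<lambda>n. - y n"] by simp

lemma square_summable_finite:
  "finite N \<Longrightarrow> (\<And>n. n \<notin> N \<Longrightarrow> x n = 0) \<Longrightarrow> square_summable x"
  unfolding square_summable_def by (rule summable_finite) auto

lemma summable_ip [simp]:
  assumes "square_summable x" "square_summable y"
  shows "summable (\<lambda>n. x n * cnj (y n))"
proof (rule summable_comparison_test')
  show "summable (\<lambda>n. (cmod (x n))\<^sup>2 + (cmod (y n))\<^sup>2)"
    using assms by (auto simp: square_summable_def intro: summable_add)
  fix n
  have "0 \<le> cmod (x n) * cmod (y n)" by simp
  then show "norm (x n * cnj (y n)) \<le> (cmod (x n))\<^sup>2 + (cmod (y n))\<^sup>2"
    using sum_squares_bound[of "cmod (x n)" "cmod (y n)"]
    unfolding norm_mult complex_mod_cnj by linarith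
qed

lemma Re_ip_ell2: "square_summable x \<Longrightarrow> Re (\<Sum>n. x n * cnj (x n)) = (\<Sum>n. (cmod (x n))\<^sup>2)"
  by (simp add: square_summable_def del: of_real_power flip: complex_norm_square suminf_of_real)

lemma complex_inner_space_ell2: "complex_inner_space ell2"
proof -
  have "abelian_group complex_ring"
  proof (rule abelian_groupI)
    show "\<exists>d\<in>carrier complex_ring. d \<oplus>\<^bsub>complex_ring\<^esub> c = \<zero>\<^bsub>complex_ring\<^esub>" for c
      by (auto simp: complex_ring_def intro: exI[of _ "- c"])
  qed (auto simp: complex_ring_def)
  then have "cring complex_ring"
    by (rule cringI) (auto simp: complex_ring_def distrib_right intro: comm_monoidI)
  moreover have "abelian_group ell2"
  proof (rule abelian_groupI)
    fix x assume "x \<in> carrier ell2"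
    then show "\<exists>y\<in>carrier ell2. y \<oplus>\<^bsub>ell2\<^esub> x = \<zero>\<^bsub>ell2\<^esub>"
      by (intro bexI[of _ "\<lambda>n. - x n"]) auto
  qed (auto simp: square_summable_finite[of "{}"] algebra_simps)
  ultimately have "Module.module complex_ring ell2"
    by (rule moduleI) (auto simp: complex_ring_def algebra_simps)
  then show ?thesis
  proof (rule complex_inner_space.intro, unfold_locales)
    fix x y z c
    assume x: "x \<in> carrier ell2" and y: "y \<in> carrier ell2"
    then show "ip ell2 (c \<odot>\<^bsub>ell2\<^esub> x) y = c * ip ell2 x y"
      by (simp add: mult.assoc suminf_mult)
    have "cnj (\<Sum>n. x n * cnj (y n)) = (\<Sum>n. cnj (x n * cnj (y n)))"
      using x y by (intro bounded_linear.suminf[OF bounded_linear_cnj]) simp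
    then show "ip ell2 y x = cnj (ip ell2 x y)"
      by (simp add: mult.commute)
    assume "z \<in> carrier ell2"
    then show "ip ell2 (x \<oplus>\<^bsub>ell2\<^esub> y) z = ip ell2 x z + ip ell2 y z"
      using x y by (simp add: distrib_right suminf_add)
  next
    fix x assume x: "x \<in> carrier ell2" and "x \<noteq> \<zero>\<^bsub>ell2\<^esub>"
    then obtain k where "x k \<noteq> 0" by auto
    then have "0 < (\<Sum>n. (cmod (x n))\<^sup>2)"
      using x by (intro suminf_pos2[of _ k]) (auto simp: square_summable_def)
    then show "0 < Re (ip ell2 x x)"
      using x by (simp add: Re_ip_ell2)
  qed
qed

interpretation ell2: complex_inner_space ell2
  by (rule complex_inner_space_ell2)

lemma ell2_uminus: "square_summable x \<Longrightarrow> \<ominus>\<^bsub>ell2\<^esub> x = (\<lambda>n. - x n)"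
  by (rule ell2.M.minus_equality) auto

lemma hnorm_ell2: "square_summable x \<Longrightarrow> hnorm ell2 x = sqrt (\<Sum>n. (cmod (x n))\<^sup>2)"
  by (simp add: hnorm_def Re_ip_ell2)

lemma hdist_ell2:
  "square_summable x \<Longrightarrow> square_summable y \<Longrightarrow>
    hdist ell2 x y = sqrt (\<Sum>n. (cmod (x n - y n))\<^sup>2)"
  using hnorm_ell2[of "\<lambda>n. x n - y n"]
  by (simp add: hdist_def a_minus_def ell2_uminus)

lemma sum_le_hdist_ell2:
  assumes "square_summable x" "square_summable y" "finite N"
  shows "(\<Sum>n\<in>N. (cmod (x n - y n))\<^sup>2) \<le> (hdist ell2 x y)\<^sup>2"
proof -
  have "summable (\<lambda>n. (cmod (x n - y n))\<^sup>2)"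
    using square_summable_diff[OF assms(1,2)] by (simp add: square_summable_def)
  then show ?thesis
    using assms by (simp add: hdist_ell2 suminf_nonneg sum_le_suminf)
qed

lemma coordinate_le_hdist_ell2:
  assumes "square_summable x" "square_summable y"
  shows "dist (x n) (y n) \<le> hdist ell2 x y"
  using sum_le_hdist_ell2[OF assms, of "{n}"]
  by (simp add: dist_norm abs_le_square_iff[symmetric])

lemma continuous_map_coordinate: "continuous_map (htopology ell2) euclidean (\<lambda>x. x n)"
proof -
  have "continuous_map ell2.mtopology Met_TC.mtopology (\<lambda>x. x n)"
    unfolding Metric_space.metric_continuous_map[OF ell2.Metric_space_axioms Met_TC.Metric_space_axioms]
  proof (intro conjI ballI allI impI)
    fix x e assume x: "x \<in> carrier ell2" and e: "e > (0::real)"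
    show "\<exists>d>0. \<forall>y. y \<in> carrier ell2 \<and> hdist ell2 x y < d \<longrightarrow> dist (x n) (y n) < e"
    proof (intro exI[of _ e] conjI allI impI)
      fix y assume y: "y \<in> carrier ell2 \<and> hdist ell2 x y < e"
      then have "dist (x n) (y n) \<le> hdist ell2 x y"
        using x by (intro coordinate_le_hdist_ell2) auto
      with y show "dist (x n) (y n) < e" by linarith
    qed (rule e)
  qed simp
  then show ?thesis by simp
qed

text \<open>
  A Cauchy sequence converges in each coordinate.  The Cauchy estimate for a finite partial sum
  survives the passage to the coordinatewise limit \<open>x\<close>, with a bound independent of the number of
  terms; so it holds for the full series.  This yields that \<open>x\<close> is square-summable, and that
  it is the limit in norm.
\<close>

lemma complex_hilbert_space_ell2: "complex_hilbert_space ell2"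
proof (rule complex_hilbert_space.intro[OF complex_inner_space_ell2], unfold_locales)
  show "ell2.mcomplete"
    unfolding ell2.mcomplete_def
  proof (intro allI impI)
    fix s assume s: "ell2.MCauchy s"
    then have ss: "square_summable (s i)" for i
      by (auto simp: ell2.MCauchy_def image_subset_iff)
    have cau: "\<exists>N. \<forall>i\<ge>N. \<forall>j\<ge>N. hdist ell2 (s i) (s j) < e" if "e > 0" for e
      using s that by (auto simp: ell2.MCauchy_def)
    have "\<exists>l. (\<lambda>i. s i n) \<longlonglongrightarrow> l" for n
    proof -
      have "Cauchy (\<lambda>i. s i n)"
        unfolding Cauchy_def
        using cau coordinate_le_hdist_ell2[OF ss ss] by (meson le_less_trans)
      then show ?thesis
        by (simp add: Cauchy_convergent_iff convergent_def)
    qed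
    then obtain x where x: "\<And>n. (\<lambda>i. s i n) \<longlonglongrightarrow> x n"
      by metis
    have tail: "square_summable (\<lambda>n. s i n - x n) \<and> (\<Sum>n. (cmod (s i n - x n))\<^sup>2) \<le> e\<^sup>2"
      if N: "\<forall>i\<ge>N. \<forall>j\<ge>N. hdist ell2 (s i) (s j) < e" and i: "i \<ge> N" for e N i
    proof -
      have bound: "(\<Sum>n<K. (cmod (s i n - x n))\<^sup>2) \<le> e\<^sup>2" for K
      proof (rule tendsto_upperbound)
        show "(\<lambda>j. \<Sum>n<K. (cmod (s i n - s j n))\<^sup>2) \<longlonglongrightarrow> (\<Sum>n<K. (cmod (s i n - x n))\<^sup>2)"
          by (intro tendsto_intros x)
        show "\<forall>\<^sub>F j in sequentially. (\<Sum>n<K. (cmod (s i n - s j n))\<^sup>2) \<le> e\<^sup>2"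
          unfolding eventually_sequentially
        proof (intro exI allI impI)
          fix j assume "j \<ge> N"
          then have "(hdist ell2 (s i) (s j))\<^sup>2 \<le> e\<^sup>2"
            using N i by (intro power_mono) (auto intro: less_imp_le)
          with sum_le_hdist_ell2[OF ss ss, of "{..<K}" i j]
          show "(\<Sum>n<K. (cmod (s i n - s j n))\<^sup>2) \<le> e\<^sup>2" by simp
        qed
      qed simp
      have "summable (\<lambda>n. (cmod (s i n - x n))\<^sup>2)"
        using bound by (intro summableI_nonneg_bounded[where x = "e\<^sup>2"]) auto
      then show ?thesis
        using bound suminf_le_const by (auto simp: square_summable_def)
    qed
    have sx: "square_summable x"
    proof -
      obtain N where "\<forall>i\<ge>N. \<forall>j\<ge>N. hdist ell2 (s i) (s j) < 1"
        using cau[of 1] by auto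
      then have "square_summable (\<lambda>n. s N n - x n)"
        using tail by blast
      from square_summable_diff[OF ss[of N] this] show ?thesis by simp
    qed
    have "limitin ell2.mtopology s x sequentially"
      unfolding ell2.limit_metric_sequentially
    proof (intro conjI allI impI)
      fix e :: real assume e: "e > 0"
      then obtain N where N: "\<forall>i\<ge>N. \<forall>j\<ge>N. hdist ell2 (s i) (s j) < e/2"
        using cau[of "e/2"] by auto
      have "hdist ell2 (s i) x < e" if "i \<ge> N" for i
      proof -
        have "hdist ell2 (s i) x \<le> sqrt ((e/2)\<^sup>2)"
          unfolding hdist_ell2[OF ss sx] using tail[OF N that] by (intro real_sqrt_le_mono) simp
        then show ?thesis using e by simp
      qed
      then show "\<exists>N. \<forall>i\<ge>N. s i \<in> carrier ell2 \<and> hdist ell2 (s i) x < e"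
        using ss by auto
    qed (simp add: sx)
    then show "\<exists>x. limitin ell2.mtopology s x sequentially" by blast
  qed
qed

section \<open>Weighted composition operators with maximal domain\<close>

definition weighted_comp ::
    "(nat \<Rightarrow> complex) \<Rightarrow> (nat \<Rightarrow> nat) \<Rightarrow> (nat \<Rightarrow> complex) \<rightharpoonup> (nat \<Rightarrow> complex)" where
  "weighted_comp w p x =
     (if square_summable x \<and> square_summable (\<lambda>n. w n * x (p n))
      then Some (\<lambda>n. w n * x (p n)) else None)"

lemma weighted_comp_eq_Some_iff:
  "weighted_comp w p x = Some y \<longleftrightarrow>
     square_summable x \<and> square_summable y \<and> (\<forall>n. y n = w n * x (p n))"
  by (auto simp: weighted_comp_def simp flip: fun_eq_iff)

lemma dom_weighted_comp:
  "x \<in> dom (weighted_comp w p) \<longleftrightarrow> square_summable x \<and> square_summable (\<lambda>n. w n * x (p n))"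
  by (simp add: weighted_comp_def dom_def)

lemma linear_weighted_comp: "linear_operator ell2 (weighted_comp w p)"
  unfolding linear_operator_def
proof (intro conjI ballI allI)
  have add: "square_summable (\<lambda>n. w n * (x (p n) + y (p n)))"
    if "square_summable (\<lambda>n. w n * x (p n))" "square_summable (\<lambda>n. w n * y (p n))" for x y
    using square_summable_add[OF that] by (simp add: distrib_left)
  have smult: "square_summable (\<lambda>n. w n * (c * x (p n)))"
    if "square_summable (\<lambda>n. w n * x (p n))" for x c
    using square_summable_smult[OF that, of c] by (simp add: mult.left_commute)
  show "submodule (dom (weighted_comp w p)) complex_ring ell2"
  proof (rule ell2.submoduleI)
    show "\<ominus>\<^bsub>ell2\<^esub> x \<in> dom (weighted_comp w p)" if "x \<in> dom (weighted_comp w p)" for x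
      using that by (simp add: dom_weighted_comp ell2_uminus)
  qed (auto simp: dom_weighted_comp weighted_comp_eq_Some_iff add smult square_summable_finite[of "{}"])
  show "ran (weighted_comp w p) \<subseteq> carrier ell2"
    by (auto simp: ran_def weighted_comp_eq_Some_iff)
  fix x assume x: "x \<in> dom (weighted_comp w p)"
  show "the (weighted_comp w p (c \<odot>\<^bsub>ell2\<^esub> x)) = c \<odot>\<^bsub>ell2\<^esub> the (weighted_comp w p x)" for c
    using x smult[of x c] by (simp add: dom_weighted_comp) (simp add: weighted_comp_def mult.left_commute)
  fix y assume y: "y \<in> dom (weighted_comp w p)"
  show "the (weighted_comp w p (x \<oplus>\<^bsub>ell2\<^esub> y))
      = the (weighted_comp w p x) \<oplus>\<^bsub>ell2\<^esub> the (weighted_comp w p y)"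
    using x y add[of x y] by (simp add: dom_weighted_comp) (simp add: weighted_comp_def distrib_left)
qed

text \<open>
  The maximal domain puts no constraint on a pair \<open>(x, y)\<close> beyond the coordinate equations
  \<open>y n = w n * x (p n)\<close>: if both vectors are square-summable and satisfy them, \<open>x\<close> is in the
  domain.  So the graph is the intersection of countably many closed conditions.
\<close>

lemma closed_weighted_comp: "closed_operator ell2 (weighted_comp w p)"
  unfolding closed_operator_def
proof (intro conjI linear_weighted_comp)
  let ?X = "prod_topology ell2.mtopology ell2.mtopology"
  have "closedin ?X {z \<in> topspace ?X. snd z n = w n * fst z (p n)}" for n
  proof (rule closedin_continuous_maps_eq[of euclidean])
    show "continuous_map ?X euclidean (\<lambda>z. snd z n)"
      using continuous_map_compose[OF continuous_map_snd continuous_map_coordinate]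
      by (simp add: o_def)
    have "continuous_map ?X euclidean (\<lambda>z. fst z (p n))"
      using continuous_map_compose[OF continuous_map_fst continuous_map_coordinate]
      by (simp add: o_def)
    moreover have "continuous_map euclidean euclidean (\<lambda>c. w n * c)"
      by (auto intro: continuous_intros)
    ultimately show "continuous_map ?X euclidean (\<lambda>z. w n * fst z (p n))"
      using continuous_map_compose[of ?X euclidean "\<lambda>z. fst z (p n)" euclidean "\<lambda>c. w n * c"]
      by (simp add: o_def)
  qed simp
  then have "closedin ?X (\<Inter>n. {z \<in> topspace ?X. snd z n = w n * fst z (p n)})"
    by (intro closedin_INT) auto
  also have "(\<Inter>n. {z \<in> topspace ?X. snd z n = w n * fst z (p n)}) = Map.graph (weighted_comp w p)"
    by (auto simp: Map.graph_def weighted_comp_eq_Some_iff)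
  finally show "closedin ?X (Map.graph (weighted_comp w p))" .
qed

text \<open>
  Injectivity of \<open>p\<close> keeps the preimage of a finite support finite; without it a single coordinate
  could be copied to infinitely many places.
\<close>

lemma finite_support_in_dom_weighted_comp:
  assumes "inj p" "finite N" "\<And>n. n \<notin> N \<Longrightarrow> x n = 0"
  shows "x \<in> dom (weighted_comp w p)"
  using assms finite_vimageI[OF assms(2,1)]
  by (auto simp: dom_weighted_comp intro: square_summable_finite[of N]
      square_summable_finite[of "p -` N"])

lemma densely_defined_weighted_comp:
  assumes p: "inj p"
  shows "densely_defined ell2 (weighted_comp w p)"
proof -
  have "\<exists>y\<in>dom (weighted_comp w p). y \<in> ell2.mball x r" if x: "square_summable x" and r: "r > 0" for x r
  proof -
    obtain N where N: "norm (\<Sum>n. (cmod (x (n + N)))\<^sup>2) < r\<^sup>2"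
      using suminf_exist_split[of "r\<^sup>2" "\<lambda>n. (cmod (x n))\<^sup>2"] x r
      by (auto simp: square_summable_def)
    define y where "y n = (if n < N then x n else 0)" for n
    have y: "square_summable y"
      by (rule square_summable_finite[of "{..<N}"]) (auto simp: y_def)
    have "summable (\<lambda>n. (cmod (x n - y n))\<^sup>2)"
      using square_summable_diff[OF x y] by (simp add: square_summable_def)
    then have "(\<Sum>n. (cmod (x n - y n))\<^sup>2) = (\<Sum>n. (cmod (x (n + N)))\<^sup>2)"
      by (subst suminf_split_initial_segment[of _ N]) (auto simp: y_def)
    then have "(\<Sum>n. (cmod (x n - y n))\<^sup>2) < r\<^sup>2"
      using N by simp
    then have "hdist ell2 x y < r"
      using x y r by (simp add: hdist_ell2 real_less_lsqrt)
    moreover have "y \<in> dom (weighted_comp w p)"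
      by (rule finite_support_in_dom_weighted_comp[OF p, of "{..<N}"]) (auto simp: y_def)
    ultimately show ?thesis
      using x y by auto
  qed
  then show ?thesis
    unfolding densely_defined_def ell2.metric_closure_of by auto
qed

text \<open>
  The unit vector supported at \<open>p n\<close> is mapped to \<open>w n\<close> times the unit vector supported at \<open>n\<close>, so a
  bound for the operator would bound all weights.
\<close>

lemma unbounded_weighted_comp:
  assumes p: "inj p" and w: "\<not> bounded (range w)"
  shows "unbounded_operator ell2 (weighted_comp w p)"
  unfolding unbounded_operator_def
proof
  assume "\<exists>c. \<forall>x\<in>dom (weighted_comp w p).
    hnorm ell2 (the (weighted_comp w p x)) \<le> c * hnorm ell2 x"
  then obtain c where c: "\<And>x. x \<in> dom (weighted_comp w p) \<Longrightarrow>
    hnorm ell2 (the (weighted_comp w p x)) \<le> c * hnorm ell2 x" by blast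
  have hnorm_single: "hnorm ell2 (\<lambda>k. if k = n then a else 0) = cmod a" for n a
  proof -
    have "(\<Sum>k. (cmod (if k = n then a else 0))\<^sup>2) = (cmod a)\<^sup>2"
      by (subst suminf_finite[of "{n}"]) auto
    moreover have "square_summable (\<lambda>k. if k = n then a else 0)"
      by (rule square_summable_finite[of "{n}"]) auto
    ultimately show ?thesis by (simp add: hnorm_ell2)
  qed
  have "norm (w n) \<le> c" for n
  proof -
    let ?e = "\<lambda>k. if k = p n then 1 else 0 :: complex"
    have e: "?e \<in> dom (weighted_comp w p)"
      by (rule finite_support_in_dom_weighted_comp[OF p, of "{p n}"]) auto
    then have "weighted_comp w p ?e = Some (\<lambda>k. w k * ?e (p k))"
      by (simp add: dom_weighted_comp weighted_comp_def)
    also have "(\<lambda>k. w k * ?e (p k)) = (\<lambda>k. if k = n then w n else 0)"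
      using p by (auto simp: inj_eq)
    finally show ?thesis
      using c[OF e] by (simp add: hnorm_single)
  qed
  then show False
    using w by (auto simp: bounded_iff)
qed

lemma not_bounded_range_if_large:
  fixes w :: "nat \<Rightarrow> complex"
  assumes "\<And>m. \<exists>n. real m \<le> norm (w n)"
  shows "\<not> bounded (range w)"
proof
  assume "bounded (range w)"
  then obtain c where "\<And>n. norm (w n) \<le> c"
    by (auto simp: bounded_iff)
  moreover obtain m where "c < real m"
    using reals_Archimedean2 by blast
  ultimately show False
    using assms[of m] by (meson linorder_not_le order_trans)
qed

section \<open>The two operators\<close>

theorem proposition2p9:
  shows "\<exists>(H :: (nat \<Rightarrow> complex) inner_space) A B.
    complex_hilbert_space H \<and>
    closed_operator H A \<and> densely_defined H A \<and> unbounded_operator H A \<and>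
    closed_operator H B \<and> densely_defined H B \<and> unbounded_operator H B \<and>
    (\<forall>T. closed_operator H T \<and> T \<circ>\<^sub>m A \<subseteq>\<^sub>m B \<circ>\<^sub>m T \<longrightarrow> T = zero_operator H)"
proof -
  define A where "A = weighted_comp (\<lambda>n. if even n then of_nat n else 0) Suc"
  define B where "B = weighted_comp (\<lambda>n. of_nat (Suc n)) id"
  have A: "closed_operator ell2 A" "densely_defined ell2 A" "unbounded_operator ell2 A"
  proof -
    have "\<not> bounded (range (\<lambda>n. if even n then of_nat n else 0 :: complex))"
      by (rule not_bounded_range_if_large) (rule_tac x = "2 * m" in exI, simp)
    then show "closed_operator ell2 A" "densely_defined ell2 A" "unbounded_operator ell2 A"
      unfolding A_def
      by (simp_all add: closed_weighted_comp densely_defined_weighted_comp unbounded_weighted_comp)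
  qed
  have B: "closed_operator ell2 B" "densely_defined ell2 B" "unbounded_operator ell2 B"
  proof -
    have "\<not> bounded (range (\<lambda>n. of_nat (Suc n) :: complex))"
      by (rule not_bounded_range_if_large) (rule exI, simp only: norm_of_nat of_nat_le_iff, rule le_SucI, rule order_refl)
    then show "closed_operator ell2 B" "densely_defined ell2 B" "unbounded_operator ell2 B"
      unfolding B_def
      by (simp_all add: closed_weighted_comp densely_defined_weighted_comp unbounded_weighted_comp
          del: of_nat_Suc)
  qed
  have square_zero: "A y = Some \<zero>\<^bsub>ell2\<^esub>" if "A x = Some y" for x y
    using that square_summable_finite[of "{}" "\<lambda>n. 0"]
    by (auto simp: A_def weighted_comp_eq_Some_iff)
  have inj: "x = \<zero>\<^bsub>ell2\<^esub>" if "B x = Some \<zero>\<^bsub>ell2\<^esub>" for x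
    using that by (auto simp: B_def weighted_comp_eq_Some_iff fun_eq_iff simp del: of_nat_Suc)
  have "T = zero_operator ell2" if "closed_operator ell2 T" "T \<circ>\<^sub>m A \<subseteq>\<^sub>m B \<circ>\<^sub>m T" for T
    using that A(2) square_zero inj by (rule ell2.intertwiner_square_zero_injective)
  then show ?thesis
    using complex_hilbert_space_ell2 A B by blast
qed

end
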